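(* Let $\mathcal{A}$ be a $\mathbb{C}$-linear abelian category with enough projectives, let $\mathcal{P}\subset\mathcal{A}$ be its full subcategory of projective objects, and let $\mathcal{B}$ be a $\mathbb{C}$-linear abelian category. For right exact additive $\mathbb{C}$-linear functors $G_1,G_2:\mathcal{A}\to\mathcal{B}$, restriction induces a bijection $$\mathrm{Nat}(G_1,G_2)\xrightarrow{\ \sim\ }\mathrm{Nat}(G_1|_{\mathcal{P}},G_2|_{\mathcal{P}}).$$ Thus a natural transformation between right exact functors is uniquely determined by, and can be reconstructed from, its restriction to projectives. In particular, every natural isomorphism $G_1|_{\mathcal{P}}\Rightarrow G_2|_{\mathcal{P}}$ extends uniquely to a natural isomorphism $G_1\Rightarrow G_2$ on $\mathcal{A}$.
   Context: A functor $G:\mathcal{A}\to\mathcal{B}$ is right exact if it sends every exact sequence $A\to B\to C\to0$ to an exact sequence $G(A)\to G(B)\to G(C)\to0$. $\mathrm{Nat}(-,-)$ denotes the set of natural transformations. *)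

theory Defs
  imports "HOL-Algebra.Module" "HOL-Algebra.Algebraic_Closure_Type" "HOL-Library.FuncSet"
begin

section \<open>Categories\<close>

text \<open>A category has a set of objects and a single set of arrows, so that hom-sets are
  automatically disjoint. Composition is written in the usual order: \<open>g \<cdot> f\<close> is
  \<open>g\<close> after \<open>f\<close>. The values of the operations outside of the objects, arrows and composable
  pairs are irrelevant.\<close>

record ('o, 'm) category =
  Obj :: "'o set"
  Arr :: "'m set"
  Dom :: "'m \<Rightarrow> 'o"
  Cod :: "'m \<Rightarrow> 'o"
  Idt :: "'o \<Rightarrow> 'm"
  Comp :: "'m \<Rightarrow> 'm \<Rightarrow> 'm"  (infixl \<open>\<cdot>\<index>\<close> 70)

definition Hom :: "('o, 'm, 'x) category_scheme \<Rightarrow> 'o \<Rightarrow> 'o \<Rightarrow> 'm set"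
  where "Hom C A B = {f \<in> Arr C. Dom C f = A \<and> Cod C f = B}"

locale category =
  fixes C :: "('o, 'm, 'x) category_scheme" (structure)
  assumes Dom_in_Obj: "f \<in> Arr C \<Longrightarrow> Dom C f \<in> Obj C"
    and Cod_in_Obj: "f \<in> Arr C \<Longrightarrow> Cod C f \<in> Obj C"
    and Idt_in_Hom: "A \<in> Obj C \<Longrightarrow> Idt C A \<in> Hom C A A"
    and Comp_in_Hom: "\<lbrakk>f \<in> Hom C A B; g \<in> Hom C B D\<rbrakk> \<Longrightarrow> g \<cdot> f \<in> Hom C A D"
    and Comp_Idt_right: "f \<in> Hom C A B \<Longrightarrow> f \<cdot> Idt C A = f"
    and Comp_Idt_left: "f \<in> Hom C A B \<Longrightarrow> Idt C B \<cdot> f = f"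
    and Comp_assoc:
      "\<lbrakk>f \<in> Hom C A B; g \<in> Hom C B D; h \<in> Hom C D E\<rbrakk> \<Longrightarrow> (h \<cdot> g) \<cdot> f = h \<cdot> (g \<cdot> f)"

definition monic :: "('o, 'm, 'x) category_scheme \<Rightarrow> 'm \<Rightarrow> bool"
  where "monic C f \<longleftrightarrow> f \<in> Arr C \<and>
    (\<forall>A. \<forall>g\<in>Hom C A (Dom C f). \<forall>h\<in>Hom C A (Dom C f). f \<cdot>\<^bsub>C\<^esub> g = f \<cdot>\<^bsub>C\<^esub> h \<longrightarrow> g = h)"

definition epic :: "('o, 'm, 'x) category_scheme \<Rightarrow> 'm \<Rightarrow> bool"
  where "epic C f \<longleftrightarrow> f \<in> Arr C \<and>
    (\<forall>B. \<forall>g\<in>Hom C (Cod C f) B. \<forall>h\<in>Hom C (Cod C f) B. g \<cdot>\<^bsub>C\<^esub> f = h \<cdot>\<^bsub>C\<^esub> f \<longrightarrow> g = h)"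

definition iso_arrow :: "('o, 'm, 'x) category_scheme \<Rightarrow> 'm \<Rightarrow> bool"
  where "iso_arrow C f \<longleftrightarrow> f \<in> Arr C \<and>
    (\<exists>g\<in>Hom C (Cod C f) (Dom C f).
       g \<cdot>\<^bsub>C\<^esub> f = Idt C (Dom C f) \<and> f \<cdot>\<^bsub>C\<^esub> g = Idt C (Cod C f))"

definition zero_object :: "('o, 'm, 'x) category_scheme \<Rightarrow> 'o \<Rightarrow> bool"
  where "zero_object C Z \<longleftrightarrow> Z \<in> Obj C \<and>
    (\<forall>A\<in>Obj C. (\<exists>!f. f \<in> Hom C A Z) \<and> (\<exists>!f. f \<in> Hom C Z A))"

definition full_subcategory ::
    "('o, 'm, 'x) category_scheme \<Rightarrow> 'o set \<Rightarrow> ('o, 'm, 'x) category_scheme"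
  where "full_subcategory C S = C\<lparr>Obj := Obj C \<inter> S,
    Arr := {f \<in> Arr C. Dom C f \<in> S \<and> Cod C f \<in> S}\<rparr>"

definition projective :: "('o, 'm, 'x) category_scheme \<Rightarrow> 'o \<Rightarrow> bool"
  where "projective C P \<longleftrightarrow> P \<in> Obj C \<and>
    (\<forall>e f. epic C e \<and> f \<in> Hom C P (Cod C e) \<longrightarrow>
       (\<exists>g\<in>Hom C P (Dom C e). e \<cdot>\<^bsub>C\<^esub> g = f))"

definition enough_projectives :: "('o, 'm, 'x) category_scheme \<Rightarrow> bool"
  where "enough_projectives C \<longleftrightarrow>
    (\<forall>A\<in>Obj C. \<exists>P e. projective C P \<and> e \<in> Hom C P A \<and> epic C e)"

definition projectives :: "('o, 'm, 'x) category_scheme \<Rightarrow> ('o, 'm, 'x) category_scheme"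
  where "projectives C = full_subcategory C {P. projective C P}"


section \<open>Complex-linear and abelian categories\<close>

record ('o, 'm) lin_category = "('o, 'm) category" +
  zero_arr :: "'o \<Rightarrow> 'o \<Rightarrow> 'm"
  add_arr :: "'m \<Rightarrow> 'm \<Rightarrow> 'm"
  scale_arr :: "complex \<Rightarrow> 'm \<Rightarrow> 'm"

text \<open>The type \<^typ>\<open>('a, 'b) module\<close> extends the type of rings; the multiplicative
  part of the record plays no role in the locale \<^locale>\<open>module\<close>.\<close>

definition hom_space ::
    "('o, 'm, 'x) lin_category_scheme \<Rightarrow> 'o \<Rightarrow> 'o \<Rightarrow> (complex, 'm) module"
  where "hom_space C A B = \<lparr>carrier = Hom C A B, monoid.mult = undefined, one = undefined,
    zero = zero_arr C A B, add = add_arr C, module.smult = scale_arr C\<rparr>"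

locale complex_linear_category = category C
  for C :: "('o, 'm, 'x) lin_category_scheme" (structure) +
  assumes hom_space_module:
      "\<lbrakk>A \<in> Obj C; B \<in> Obj C\<rbrakk> \<Longrightarrow> module (ring_of_type_algebra :: complex ring) (hom_space C A B)"
    and Comp_add_right: "\<lbrakk>f \<in> Hom C A B; f' \<in> Hom C A B; g \<in> Hom C B D\<rbrakk> \<Longrightarrow>
      g \<cdot> add_arr C f f' = add_arr C (g \<cdot> f) (g \<cdot> f')"
    and Comp_add_left: "\<lbrakk>f \<in> Hom C A B; g \<in> Hom C B D; g' \<in> Hom C B D\<rbrakk> \<Longrightarrow>
      add_arr C g g' \<cdot> f = add_arr C (g \<cdot> f) (g' \<cdot> f)"
    and Comp_scale_right: "\<lbrakk>f \<in> Hom C A B; g \<in> Hom C B D\<rbrakk> \<Longrightarrow>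
      g \<cdot> scale_arr C c f = scale_arr C c (g \<cdot> f)"
    and Comp_scale_left: "\<lbrakk>f \<in> Hom C A B; g \<in> Hom C B D\<rbrakk> \<Longrightarrow>
      scale_arr C c g \<cdot> f = scale_arr C c (g \<cdot> f)"

definition is_kernel :: "('o, 'm, 'x) lin_category_scheme \<Rightarrow> 'm \<Rightarrow> 'm \<Rightarrow> bool"
  where "is_kernel C f k \<longleftrightarrow> f \<in> Arr C \<and> k \<in> Arr C \<and> Cod C k = Dom C f \<and>
    f \<cdot>\<^bsub>C\<^esub> k = zero_arr C (Dom C k) (Cod C f) \<and>
    (\<forall>A. \<forall>h\<in>Hom C A (Dom C f). f \<cdot>\<^bsub>C\<^esub> h = zero_arr C A (Cod C f) \<longrightarrow>
       (\<exists>!u. u \<in> Hom C A (Dom C k) \<and> k \<cdot>\<^bsub>C\<^esub> u = h))"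

definition is_cokernel :: "('o, 'm, 'x) lin_category_scheme \<Rightarrow> 'm \<Rightarrow> 'm \<Rightarrow> bool"
  where "is_cokernel C f c \<longleftrightarrow> f \<in> Arr C \<and> c \<in> Arr C \<and> Dom C c = Cod C f \<and>
    c \<cdot>\<^bsub>C\<^esub> f = zero_arr C (Dom C f) (Cod C c) \<and>
    (\<forall>B. \<forall>h\<in>Hom C (Cod C f) B. h \<cdot>\<^bsub>C\<^esub> f = zero_arr C (Dom C f) B \<longrightarrow>
       (\<exists>!u. u \<in> Hom C (Cod C c) B \<and> u \<cdot>\<^bsub>C\<^esub> c = h))"

definition is_biproduct :: "('o, 'm, 'x) lin_category_scheme \<Rightarrow>
    'o \<Rightarrow> 'o \<Rightarrow> 'o \<Rightarrow> 'm \<Rightarrow> 'm \<Rightarrow> 'm \<Rightarrow> 'm \<Rightarrow> bool"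
  where "is_biproduct C A B S i1 i2 p1 p2 \<longleftrightarrow>
    i1 \<in> Hom C A S \<and> i2 \<in> Hom C B S \<and> p1 \<in> Hom C S A \<and> p2 \<in> Hom C S B \<and>
    p1 \<cdot>\<^bsub>C\<^esub> i1 = Idt C A \<and> p2 \<cdot>\<^bsub>C\<^esub> i2 = Idt C B \<and>
    p2 \<cdot>\<^bsub>C\<^esub> i1 = zero_arr C A B \<and> p1 \<cdot>\<^bsub>C\<^esub> i2 = zero_arr C B A \<and>
    add_arr C (i1 \<cdot>\<^bsub>C\<^esub> p1) (i2 \<cdot>\<^bsub>C\<^esub> p2) = Idt C S"

locale complex_linear_abelian_category = complex_linear_category C
  for C :: "('o, 'm, 'x) lin_category_scheme" (structure) +
  assumes ex_zero_object: "\<exists>Z. zero_object C Z"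
    and ex_biproduct: "\<lbrakk>A \<in> Obj C; B \<in> Obj C\<rbrakk> \<Longrightarrow> \<exists>S i1 i2 p1 p2. is_biproduct C A B S i1 i2 p1 p2"
    and ex_kernel: "f \<in> Arr C \<Longrightarrow> \<exists>k. is_kernel C f k"
    and ex_cokernel: "f \<in> Arr C \<Longrightarrow> \<exists>c. is_cokernel C f c"
    and monic_is_kernel: "monic C f \<Longrightarrow> \<exists>g. is_kernel C g f"
    and epic_is_cokernel: "epic C f \<Longrightarrow> \<exists>g. is_cokernel C g f"

text \<open>The image of an arrow is the kernel of its cokernel; \<open>\<cdot> \<rightarrow>f \<cdot> \<rightarrow>g \<cdot>\<close> is exact
  if the image of \<open>f\<close> is the kernel of \<open>g\<close>, as subobjects of the middle object.\<close>

definition is_image :: "('o, 'm, 'x) lin_category_scheme \<Rightarrow> 'm \<Rightarrow> 'm \<Rightarrow> bool"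
  where "is_image C f m \<longleftrightarrow> (\<exists>c. is_cokernel C f c \<and> is_kernel C c m)"

definition exact_at :: "('o, 'm, 'x) lin_category_scheme \<Rightarrow> 'm \<Rightarrow> 'm \<Rightarrow> bool"
  where "exact_at C f g \<longleftrightarrow> f \<in> Arr C \<and> g \<in> Arr C \<and> Cod C f = Dom C g \<and>
    (\<exists>m. is_image C f m \<and> is_kernel C g m)"

text \<open>Exactness of \<open>A \<rightarrow>f B \<rightarrow>g D \<rightarrow> 0\<close>, at \<open>B\<close> and at \<open>D\<close>.\<close>

definition right_exact_sequence :: "('o, 'm, 'x) lin_category_scheme \<Rightarrow> 'm \<Rightarrow> 'm \<Rightarrow> bool"
  where "right_exact_sequence C f g \<longleftrightarrow> exact_at C f g \<and>
    (\<exists>Z. zero_object C Z \<and> exact_at C g (zero_arr C (Cod C g) Z))"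


section \<open>Functors and natural transformations\<close>

record ('o1, 'm1, 'o2, 'm2) functor_data =
  fobj :: "'o1 \<Rightarrow> 'o2"
  farr :: "'m1 \<Rightarrow> 'm2"

locale category_functor = src: category C + tgt: category D
  for C :: "('o1, 'm1, 'x) category_scheme"
    and D :: "('o2, 'm2, 'y) category_scheme"
    and F :: "('o1, 'm1, 'o2, 'm2) functor_data" +
  assumes fobj_in_Obj: "A \<in> Obj C \<Longrightarrow> fobj F A \<in> Obj D"
    and farr_in_Hom: "f \<in> Hom C A B \<Longrightarrow> farr F f \<in> Hom D (fobj F A) (fobj F B)"
    and farr_Idt: "A \<in> Obj C \<Longrightarrow> farr F (Idt C A) = Idt D (fobj F A)"
    and farr_Comp: "\<lbrakk>f \<in> Hom C A B; g \<in> Hom C B E\<rbrakk> \<Longrightarrow>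
      farr F (g \<cdot>\<^bsub>C\<^esub> f) = farr F g \<cdot>\<^bsub>D\<^esub> farr F f"

definition additive_functor :: "('o1, 'm1, 'x) lin_category_scheme \<Rightarrow>
    ('o2, 'm2, 'y) lin_category_scheme \<Rightarrow> ('o1, 'm1, 'o2, 'm2) functor_data \<Rightarrow> bool"
  where "additive_functor C D F \<longleftrightarrow> category_functor C D F \<and>
    (\<forall>A B. \<forall>f\<in>Hom C A B. \<forall>g\<in>Hom C A B.
       farr F (add_arr C f g) = add_arr D (farr F f) (farr F g))"

definition complex_linear_functor :: "('o1, 'm1, 'x) lin_category_scheme \<Rightarrow>
    ('o2, 'm2, 'y) lin_category_scheme \<Rightarrow> ('o1, 'm1, 'o2, 'm2) functor_data \<Rightarrow> bool"
  where "complex_linear_functor C D F \<longleftrightarrow> additive_functor C D F \<and>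
    (\<forall>c. \<forall>f\<in>Arr C. farr F (scale_arr C c f) = scale_arr D c (farr F f))"

definition right_exact_functor :: "('o1, 'm1, 'x) lin_category_scheme \<Rightarrow>
    ('o2, 'm2, 'y) lin_category_scheme \<Rightarrow> ('o1, 'm1, 'o2, 'm2) functor_data \<Rightarrow> bool"
  where "right_exact_functor C D F \<longleftrightarrow> category_functor C D F \<and>
    (\<forall>f g. right_exact_sequence C f g \<longrightarrow> right_exact_sequence D (farr F f) (farr F g))"

definition restrict_functor :: "('o1, 'm1, 'o2, 'm2) functor_data \<Rightarrow>
    ('o1, 'm1, 'x) category_scheme \<Rightarrow> ('o1, 'm1, 'o2, 'm2) functor_data"
  where "restrict_functor F S =
    \<lparr>fobj = restrict (fobj F) (Obj S), farr = restrict (farr F) (Arr S)\<rparr>"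

text \<open>Families of components are required to be extensional (equal to \<^const>\<open>undefined\<close>
  outside the objects), so that a transformation is determined by its components
  and \<open>Nat\<close> is the true set of natural transformations.\<close>

definition Nat :: "('o1, 'm1, 'x) category_scheme \<Rightarrow> ('o2, 'm2, 'y) category_scheme \<Rightarrow>
    ('o1, 'm1, 'o2, 'm2) functor_data \<Rightarrow> ('o1, 'm1, 'o2, 'm2) functor_data \<Rightarrow> ('o1 \<Rightarrow> 'm2) set"
  where "Nat C D F G =
    {\<tau> \<in> (\<Pi>\<^sub>E A\<in>Obj C. Hom D (fobj F A) (fobj G A)).
       \<forall>A B. \<forall>f\<in>Hom C A B. \<tau> B \<cdot>\<^bsub>D\<^esub> farr F f = farr G f \<cdot>\<^bsub>D\<^esub> \<tau> A}"

definition NatIso :: "('o1, 'm1, 'x) category_scheme \<Rightarrow> ('o2, 'm2, 'y) category_scheme \<Rightarrow>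
    ('o1, 'm1, 'o2, 'm2) functor_data \<Rightarrow> ('o1, 'm1, 'o2, 'm2) functor_data \<Rightarrow> ('o1 \<Rightarrow> 'm2) set"
  where "NatIso C D F G = {\<tau> \<in> Nat C D F G. \<forall>A\<in>Obj C. iso_arrow D (\<tau> A)}"

definition restrict_nat :: "('o1, 'm1, 'x) category_scheme \<Rightarrow> ('o1 \<Rightarrow> 'm2) \<Rightarrow> ('o1 \<Rightarrow> 'm2)"
  where "restrict_nat S \<tau> = restrict \<tau> (Obj S)"


section \<open>Restriction to full subcategories is well defined\<close>

lemma Hom_full_subcategory:
  "Hom (full_subcategory C S) A B = (if A \<in> S \<and> B \<in> S then Hom C A B else {})"
  by (auto simp: Hom_def full_subcategory_def)

lemma (in category) category_full_subcategory: "category (full_subcategory C S)"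
proof -
  have [simp]: "Obj (full_subcategory C S) = Obj C \<inter> S"
    "Dom (full_subcategory C S) = Dom C" "Cod (full_subcategory C S) = Cod C"
    "Idt (full_subcategory C S) = Idt C" "Comp (full_subcategory C S) = Comp C"
    "Arr (full_subcategory C S) = {f \<in> Arr C. Dom C f \<in> S \<and> Cod C f \<in> S}"
    by (simp_all add: full_subcategory_def)
  show ?thesis
    by unfold_locales
      (auto simp: Hom_full_subcategory Dom_in_Obj Cod_in_Obj Idt_in_Hom Comp_Idt_right
         Comp_Idt_left intro: Comp_in_Hom Comp_assoc split: if_splits)
qed

lemma (in category_functor) category_functor_restrict:
  "category_functor (full_subcategory C S) D (restrict_functor F (full_subcategory C S))"
proof -
  let ?S = "full_subcategory C S"
  interpret sub: category ?S
    by (rule src.category_full_subcategory)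
  have [simp]: "Obj ?S = Obj C \<inter> S" "Idt ?S = Idt C" "Comp ?S = Comp C"
    by (simp_all add: full_subcategory_def)
  have HomD: "f \<in> Hom C A B \<and> A \<in> Obj ?S \<and> B \<in> Obj ?S \<and> f \<in> Arr ?S"
    if "f \<in> Hom ?S A B" for f A B
    using that sub.Dom_in_Obj sub.Cod_in_Obj
    by (auto simp: Hom_full_subcategory split: if_splits)
      (auto simp: Hom_def full_subcategory_def src.Dom_in_Obj src.Cod_in_Obj)
  have Idt_Arr: "Idt C A \<in> Arr ?S" if "A \<in> Obj ?S" for A
    using sub.Idt_in_Hom[OF that] by (simp add: Hom_def)
  show ?thesis
  proof unfold_locales
    fix A assume "A \<in> Obj ?S"
    then show "fobj (restrict_functor F ?S) A \<in> Obj D"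
      by (simp add: restrict_functor_def fobj_in_Obj)
  next
    fix f A B assume "f \<in> Hom ?S A B"
    then show "farr (restrict_functor F ?S) f
        \<in> Hom D (fobj (restrict_functor F ?S) A) (fobj (restrict_functor F ?S) B)"
      using HomD[of f A B] farr_in_Hom[of f A B] by (simp add: restrict_functor_def)
  next
    fix A assume "A \<in> Obj ?S"
    then show "farr (restrict_functor F ?S) (Idt ?S A) = Idt D (fobj (restrict_functor F ?S) A)"
      using Idt_Arr[of A] by (simp add: restrict_functor_def farr_Idt)
  next
    fix f A B g E assume fg: "f \<in> Hom ?S A B" "g \<in> Hom ?S B E"
    then have "g \<cdot>\<^bsub>C\<^esub> f \<in> Arr ?S"
      using sub.Comp_in_Hom[OF fg] by (simp add: Hom_def)
    then show "farr (restrict_functor F ?S) (g \<cdot>\<^bsub>?S\<^esub> f) =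
        farr (restrict_functor F ?S) g \<cdot>\<^bsub>D\<^esub> farr (restrict_functor F ?S) f"
      using HomD[OF fg(1)] HomD[OF fg(2)] farr_Comp[of f A B g E]
      by (simp add: restrict_functor_def)
  qed
qed

end

theory Submission
  imports Defs
begin

text \<open>In an abelian category with enough projectives every object \<open>A\<close> is a cokernel of an arrow
  \<open>d: Q \<rightarrow> P\<close> between projectives. A right exact functor preserves cokernels, because a right exact
  sequence is the same thing as a cokernel diagram
  (\<open>right_exact_sequence_iff_is_cokernel\<close>). So a right exact functor \<open>F\<close> is computed, on objects
  and on arrows, from its values on projectives, and the same holds for transformations out of it.

  In detail, let \<open>e: P \<rightarrow> A\<close> be a cokernel of \<open>d\<close>. Then \<open>F e\<close> is epic, and a natural
  transformation \<open>\<tau>\<close> satisfies \<open>\<tau>\<^sub>A \<cdot> F e = G e \<cdot> \<tau>\<^sub>P\<close>, so \<open>\<tau>\<^sub>P\<close> determines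
  \<open>\<tau>\<^sub>A\<close>. Conversely, if \<open>\<sigma>\<close> is natural on projectives, then
  \<open>G e \<cdot> \<sigma>\<^sub>P \<cdot> F d = G e \<cdot> G d \<cdot> \<sigma>\<^sub>Q = 0\<close>, and \<open>G e \<cdot> \<sigma>\<^sub>P\<close> factors through the
  cokernel \<open>F e\<close> of \<open>F d\<close>. The factor is the component of the extension at \<open>A\<close>
  (\<open>ex_extends_at\<close>).

  To avoid any dependence on the choice of \<open>e\<close>, the component at \<open>A\<close> is characterised by its
  composites with \<open>F f\<close> for all arrows \<open>f\<close> from projectives to \<open>A\<close> (\<open>extends_at\<close>). Since these
  composites separate arrows out of \<open>F A\<close> (\<open>component_ext\<close>), naturality of the extension can
  be tested after composing with arrows from projectives. For isomorphisms, the
  pointwise inverse of \<open>\<sigma>\<close> is natural on projectives and extends too; the two extensions are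
  mutually inverse because they are so on projectives.\<close>

section \<open>Zero arrows, epimorphisms and cokernels\<close>

context category
begin

lemma Hom_objects: "f \<in> Hom C A B \<Longrightarrow> A \<in> Obj C \<and> B \<in> Obj C"
  using Dom_in_Obj Cod_in_Obj by (auto simp: Hom_def)

lemma epic_cancel:
  assumes "epic C e" "e \<in> Hom C A B" "g \<in> Hom C B Y" "h \<in> Hom C B Y" "g \<cdot> e = h \<cdot> e"
  shows "g = h"
  using assms by (auto simp: epic_def Hom_def)

lemma projective_lift:
  assumes "projective C Q" "epic C e" "e \<in> Hom C P A" "f \<in> Hom C Q A"
  obtains g where "g \<in> Hom C Q P" "e \<cdot> g = f"
  using assms by (auto simp: projective_def Hom_def)

end

context complex_linear_category
begin

lemma hom_space_abelian_group:
  assumes "A \<in> Obj C" "B \<in> Obj C"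
  shows "abelian_group (hom_space C A B)"
  using hom_space_module[OF assms] by (rule module.axioms(2))

lemma zero_arr_in_Hom: "\<lbrakk>A \<in> Obj C; B \<in> Obj C\<rbrakk> \<Longrightarrow> zero_arr C A B \<in> Hom C A B"
  using abelian_group.axioms(1)[OF hom_space_abelian_group, THEN abelian_monoid.zero_closed]
  by (simp add: hom_space_def)

lemma add_zero_arr: "f \<in> Hom C A B \<Longrightarrow> add_arr C f (zero_arr C A B) = f"
  using abelian_group.axioms(1)[OF hom_space_abelian_group[of A B], THEN abelian_monoid.r_zero, of f]
    Hom_objects[of f A B]
  by (simp add: hom_space_def)

lemma ex_neg_arr:
  assumes "f \<in> Hom C A B"
  obtains n where "n \<in> Hom C A B" "add_arr C f n = zero_arr C A B"
proof -
  interpret H: abelian_group "hom_space C A B"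
    using hom_space_abelian_group Hom_objects[OF assms] by blast
  show thesis
    using that[of "\<ominus>\<^bsub>hom_space C A B\<^esub> f"] H.a_inv_closed[of f] H.r_neg[of f] assms
    by (simp add: hom_space_def)
qed

lemma add_arr_cancel:
  assumes "f \<in> Hom C A B" "g \<in> Hom C A B" "h \<in> Hom C A B" "add_arr C f h = add_arr C g h"
  shows "f = g"
proof -
  interpret H: abelian_group "hom_space C A B"
    using hom_space_abelian_group Hom_objects[OF assms(1)] by blast
  show ?thesis
    using H.add.r_cancel[of f h g] assms by (simp add: hom_space_def)
qed

text \<open>Composition with a fixed arrow is additive, so it sends the zero arrow to an arrow that is
  equal to its own double; this is how zero arrows are seen to absorb composition.\<close>

lemma zero_arr_if_eq_double:
  assumes "f \<in> Hom C A B" "add_arr C f f = f"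
  shows "f = zero_arr C A B"
proof -
  interpret H: abelian_group "hom_space C A B"
    using hom_space_abelian_group Hom_objects[OF assms(1)] by blast
  show ?thesis
    using H.add.l_cancel_one[of f f] assms by (simp add: hom_space_def)
qed

lemma Comp_zero_right:
  assumes "g \<in> Hom C B D" "A \<in> Obj C"
  shows "g \<cdot> zero_arr C A B = zero_arr C A D"
proof -
  have z: "zero_arr C A B \<in> Hom C A B"
    using zero_arr_in_Hom assms Hom_objects by blast
  show ?thesis
    using zero_arr_if_eq_double Comp_in_Hom[OF z assms(1)] Comp_add_right[OF z z assms(1)]
      add_zero_arr[OF z] by metis
qed

lemma Comp_zero_left:
  assumes "f \<in> Hom C A B" "D \<in> Obj C"
  shows "zero_arr C B D \<cdot> f = zero_arr C A D"
proof -
  have z: "zero_arr C B D \<in> Hom C B D"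
    using zero_arr_in_Hom assms Hom_objects by blast
  show ?thesis
    using zero_arr_if_eq_double Comp_in_Hom[OF assms(1) z] Comp_add_left[OF assms(1) z z]
      add_zero_arr[OF z] by metis
qed

text \<open>Right cancellation only has to be tested against zero: if \<open>g \<cdot> e = h \<cdot> e\<close>, then
  \<open>g - h\<close> is killed by \<open>e\<close>.\<close>

lemma epicI_zero:
  assumes e: "e \<in> Hom C A B"
    and zero: "\<And>Y h. \<lbrakk>h \<in> Hom C B Y; h \<cdot> e = zero_arr C A Y\<rbrakk> \<Longrightarrow> h = zero_arr C B Y"
  shows "epic C e"
proof -
  have "g = h" if gh: "g \<in> Hom C B Y" "h \<in> Hom C B Y" "g \<cdot> e = h \<cdot> e" for Y g h
  proof -
    obtain n where n: "n \<in> Hom C B Y" "add_arr C h n = zero_arr C B Y"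
      using ex_neg_arr[OF gh(2)] .
    have gn: "add_arr C g n \<in> Hom C B Y"
    proof -
      interpret H: abelian_group "hom_space C B Y"
        using hom_space_abelian_group Hom_objects[OF n(1)] by blast
      show ?thesis
        using H.a_closed[of g n] gh n by (simp add: hom_space_def)
    qed
    have "add_arr C g n \<cdot> e = add_arr C h n \<cdot> e"
      using Comp_add_left[OF e gh(1) n(1)] Comp_add_left[OF e gh(2) n(1)] gh(3) by simp
    also have "\<dots> = zero_arr C A Y"
      using n Comp_zero_left[OF e] Hom_objects[OF n(1)] by simp
    finally have "add_arr C g n = add_arr C h n"
      using zero[OF gn] n(2) by simp
    then show ?thesis
      using add_arr_cancel gh n by blast
  qed
  then show ?thesis
    using e by (auto simp: epic_def Hom_def)
qed

lemma zero_object_arr_eq: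
  assumes "zero_object C Z" "f \<in> Hom C Z B" "g \<in> Hom C Z B"
  shows "f = g"
proof -
  have "\<exists>!f. f \<in> Hom C Z B"
    using assms(1) Hom_objects[OF assms(2)] by (simp add: zero_object_def)
  then show ?thesis
    using assms(2,3) by blast
qed

lemma is_kernelD:
  assumes "is_kernel C f k" "f \<in> Hom C A B"
  shows "k \<in> Hom C (Dom C k) A" "f \<cdot> k = zero_arr C (Dom C k) B"
  using assms by (auto simp: is_kernel_def Hom_def)

lemma is_kernel_factor:
  assumes "is_kernel C f k" "f \<in> Hom C A B" "h \<in> Hom C Y A" "f \<cdot> h = zero_arr C Y B"
  obtains u where "u \<in> Hom C Y (Dom C k)" "k \<cdot> u = h"
proof -
  have f: "Dom C f = A" "Cod C f = B"
    using assms(2) by (simp_all add: Hom_def)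
  have "\<exists>!u. u \<in> Hom C Y (Dom C k) \<and> k \<cdot> u = h"
    using assms(1,3,4) unfolding is_kernel_def f by blast
  then show thesis
    using that by blast
qed

lemma is_cokernelD:
  assumes "is_cokernel C f c" "c \<in> Hom C B Q"
  shows "f \<in> Hom C (Dom C f) B" "c \<cdot> f = zero_arr C (Dom C f) Q"
  using assms by (auto simp: is_cokernel_def Hom_def)

lemma is_cokernel_factor:
  assumes "is_cokernel C f c" "f \<in> Hom C A B" "h \<in> Hom C B Y" "h \<cdot> f = zero_arr C A Y"
  obtains u where "u \<in> Hom C (Cod C c) Y" "u \<cdot> c = h"
proof -
  have f: "Dom C f = A" "Cod C f = B"
    using assms(2) by (simp_all add: Hom_def)
  have "\<exists>!u. u \<in> Hom C (Cod C c) Y \<and> u \<cdot> c = h"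
    using assms(1,3,4) unfolding is_cokernel_def f by blast
  then show thesis
    using that by blast
qed

lemma is_cokernel_epic:
  assumes "is_cokernel C f c"
  shows "epic C c"
proof -
  have fc: "f \<in> Hom C (Dom C f) (Cod C f)" "c \<in> Hom C (Cod C f) (Cod C c)"
    "c \<cdot> f = zero_arr C (Dom C f) (Cod C c)"
    using assms by (auto simp: is_cokernel_def Hom_def)
  have "g = h" if gh: "g \<in> Hom C (Cod C c) Y" "h \<in> Hom C (Cod C c) Y" "g \<cdot> c = h \<cdot> c" for Y g h
  proof -
    have "(g \<cdot> c) \<cdot> f = zero_arr C (Dom C f) Y"
      using Comp_assoc[OF fc(1,2) gh(1)] fc Comp_zero_right[OF gh(1)] Hom_objects by simp
    then have "\<exists>!u. u \<in> Hom C (Cod C c) Y \<and> u \<cdot> c = g \<cdot> c"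
      using assms Comp_in_Hom[OF fc(2) gh(1)] unfolding is_cokernel_def by blast
    then show ?thesis
      using gh by metis
  qed
  then show ?thesis
    using fc(2) by (auto simp: epic_def Hom_def)
qed

text \<open>For an epimorphism the uniqueness half of the universal property of a cokernel is automatic.\<close>

lemma is_cokernelI_epic:
  assumes f: "f \<in> Hom C A B" and c: "c \<in> Hom C B Q" and "epic C c"
    and cf: "c \<cdot> f = zero_arr C A Q"
    and factor: "\<And>Y h. \<lbrakk>h \<in> Hom C B Y; h \<cdot> f = zero_arr C A Y\<rbrakk> \<Longrightarrow> \<exists>u\<in>Hom C Q Y. u \<cdot> c = h"
  shows "is_cokernel C f c"
proof -
  have "\<exists>!u. u \<in> Hom C Q Y \<and> u \<cdot> c = h"
    if h: "h \<in> Hom C B Y" "h \<cdot> f = zero_arr C A Y" for Y h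
    using factor[OF h] epic_cancel[OF \<open>epic C c\<close> c] by metis
  then show ?thesis
    using f c cf by (auto simp: is_cokernel_def Hom_def)
qed

end

section \<open>Right exact sequences are cokernel diagrams\<close>

context complex_linear_abelian_category
begin

text \<open>Exactness at the last term says that \<open>g\<close> has zero cokernel, that is, that \<open>g\<close> is epic;
  then \<open>g\<close> is itself a cokernel of some arrow \<open>r\<close>. Exactness at the middle term says that a
  cokernel \<open>c\<close> of \<open>f\<close> and the arrow \<open>g\<close> have a common kernel \<open>m\<close>. An arrow that kills \<open>f\<close>
  factors through \<open>c\<close>, hence kills \<open>m\<close>, hence kills \<open>r\<close>, which factors through \<open>m\<close>; so it factors
  through \<open>g\<close>. Conversely, a cokernel \<open>g\<close> of \<open>f\<close> can serve as \<open>c\<close>.\<close>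

lemma right_exact_sequence_iff_is_cokernel: "right_exact_sequence C f g \<longleftrightarrow> is_cokernel C f g"
proof
  assume cok: "is_cokernel C f g"
  define A B D where "A = Dom C f" and "B = Cod C f" and "D = Cod C g"
  have fg: "f \<in> Hom C A B" "g \<in> Hom C B D"
    using cok by (auto simp: is_cokernel_def Hom_def A_def B_def D_def)
  have D: "D \<in> Obj C"
    using Hom_objects[OF fg(2)] by simp
  have epic: "epic C g"
    using cok by (rule is_cokernel_epic)
  obtain k where "is_kernel C g k"
    using ex_kernel fg by (auto simp: Hom_def)
  then have "exact_at C f g"
    using cok fg unfolding exact_at_def is_image_def by (auto simp: Hom_def)
  moreover obtain Z where Z: "zero_object C Z"
    using ex_zero_object by blast
  have Z_obj: "Z \<in> Obj C"
    using Z by (simp add: zero_object_def)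
  have z: "zero_arr C D Z \<in> Hom C D Z"
    using zero_arr_in_Hom D Z_obj by blast
  \<comment> \<open>Exactness at the last term: \<open>D \<rightarrow> 0\<close> is a cokernel of the epimorphism \<open>g\<close>, and the
    identity is a kernel of \<open>D \<rightarrow> 0\<close>.\<close>
  have "is_cokernel C g (zero_arr C D Z)"
  proof (rule is_cokernelI_epic[OF fg(2) z])
    show "epic C (zero_arr C D Z)"
    proof (rule epicI_zero[OF z])
      fix Y h assume "h \<in> Hom C Z Y" "h \<cdot> zero_arr C D Z = zero_arr C D Y"
      then show "h = zero_arr C Z Y"
        using zero_object_arr_eq[OF Z] zero_arr_in_Hom Hom_objects by blast
    qed
    show "zero_arr C D Z \<cdot> g = zero_arr C B Z"
      using Comp_zero_left fg Z_obj by blast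
    fix Y h assume h: "h \<in> Hom C D Y" "h \<cdot> g = zero_arr C B Y"
    have Y: "Y \<in> Obj C"
      using Hom_objects[OF h(1)] by simp
    have "h = zero_arr C D Y"
      using epic_cancel[OF epic fg(2) h(1) zero_arr_in_Hom[OF D Y]] h(2) Comp_zero_left[OF fg(2) Y]
      by simp
    then show "\<exists>u\<in>Hom C Z Y. u \<cdot> zero_arr C D Z = h"
      using Comp_zero_left[OF z Y] zero_arr_in_Hom[OF Z_obj Y] by blast
  qed
  moreover have "is_kernel C (zero_arr C D Z) (Idt C D)"
  proof -
    have i: "Idt C D \<in> Hom C D D"
      using Idt_in_Hom D by blast
    have "\<exists>!u. u \<in> Hom C Y D \<and> Idt C D \<cdot> u = h" if "h \<in> Hom C Y D" for Y h
      using that Comp_Idt_left by metis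
    then show ?thesis
      using z i Comp_Idt_right[OF z] unfolding is_kernel_def by (simp add: Hom_def)
  qed
  ultimately have "exact_at C g (zero_arr C D Z)"
    using fg z unfolding exact_at_def is_image_def by (auto simp: Hom_def)
  with \<open>exact_at C f g\<close> Z show "right_exact_sequence C f g"
    unfolding right_exact_sequence_def D_def by blast
next
  assume ex: "right_exact_sequence C f g"
  define A B D where "A = Dom C f" and "B = Cod C f" and "D = Cod C g"
  have fg: "f \<in> Hom C A B" "g \<in> Hom C B D"
    using ex by (auto simp: right_exact_sequence_def exact_at_def Hom_def A_def B_def D_def)
  have D: "D \<in> Obj C"
    using Hom_objects[OF fg(2)] by simp
  from ex obtain m c where m: "is_kernel C g m" and c: "is_cokernel C f c" "is_kernel C c m"
    unfolding right_exact_sequence_def exact_at_def is_image_def by blast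
  from ex obtain Z m' c' where Z: "zero_object C Z" and m': "is_kernel C (zero_arr C D Z) m'"
    and c': "is_cokernel C g c'" "is_kernel C c' m'"
    unfolding right_exact_sequence_def exact_at_def is_image_def D_def by blast
  have z: "zero_arr C D Z \<in> Hom C D Z"
    using zero_arr_in_Hom D Z by (auto simp: zero_object_def)
  have c_Hom: "c \<in> Hom C B (Cod C c)" and c'_Hom: "c' \<in> Hom C D (Cod C c')"
    using c c' by (auto simp: is_cokernel_def Hom_def B_def D_def)
  have m_Hom: "m \<in> Hom C (Dom C m) B"
    using is_kernelD(1)[OF m fg(2)] .
  have m'_Hom: "m' \<in> Hom C (Dom C m') D"
    using is_kernelD(1)[OF m' z] .
  \<comment> \<open>The kernel of \<open>D \<rightarrow> 0\<close> has a section, so the arrow \<open>c'\<close>, which kills it, is zero.\<close>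
  obtain s where s: "s \<in> Hom C D (Dom C m')" "m' \<cdot> s = Idt C D"
    by (rule is_kernel_factor[OF m' z Idt_in_Hom[OF D] Comp_Idt_right[OF z]])
  have "c' = c' \<cdot> (m' \<cdot> s)"
    using s Comp_Idt_right[OF c'_Hom] by simp
  also have "\<dots> = (c' \<cdot> m') \<cdot> s"
    using Comp_assoc[OF s(1) m'_Hom c'_Hom] by simp
  also have "\<dots> = zero_arr C D (Cod C c')"
    using is_kernelD(2)[OF c'(2) c'_Hom] Comp_zero_left[OF s(1)] Hom_objects[OF c'_Hom] by simp
  finally have c'_zero: "c' = zero_arr C D (Cod C c')" .
  have epic: "epic C g"
  proof (rule epicI_zero[OF fg(2)])
    fix Y h assume h: "h \<in> Hom C D Y" "h \<cdot> g = zero_arr C B Y"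
    obtain u where "u \<in> Hom C (Cod C c') Y" "u \<cdot> c' = h"
      using is_cokernel_factor[OF c'(1) fg(2) h] .
    then show "h = zero_arr C D Y"
      using c'_zero Comp_zero_right D by metis
  qed
  obtain r where r: "is_cokernel C r g"
    using epic_is_cokernel[OF epic] by blast
  have r_Hom: "r \<in> Hom C (Dom C r) B" and gr: "g \<cdot> r = zero_arr C (Dom C r) D"
    using is_cokernelD[OF r fg(2)] by auto
  obtain v where v: "v \<in> Hom C (Dom C r) (Dom C m)" "m \<cdot> v = r"
    using is_kernel_factor[OF m fg(2) r_Hom gr] .
  show "is_cokernel C f g"
  proof (rule is_cokernelI_epic[OF fg epic])
    have "c \<cdot> f = zero_arr C A (Cod C c)"
      using is_cokernelD(2)[OF c(1) c_Hom] by (simp add: A_def)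
    then obtain w where w: "w \<in> Hom C A (Dom C m)" "m \<cdot> w = f"
      by (rule is_kernel_factor[OF c(2) c_Hom fg(1)])
    have "g \<cdot> f = (g \<cdot> m) \<cdot> w"
      using Comp_assoc[OF w(1) m_Hom fg(2)] w by simp
    then show "g \<cdot> f = zero_arr C A D"
      using is_kernelD(2)[OF m fg(2)] Comp_zero_left[OF w(1) D] by simp
  next
    fix Y h assume h: "h \<in> Hom C B Y" "h \<cdot> f = zero_arr C A Y"
    have Y: "Y \<in> Obj C"
      using Hom_objects[OF h(1)] by simp
    obtain u where u: "u \<in> Hom C (Cod C c) Y" "u \<cdot> c = h"
      using is_cokernel_factor[OF c(1) fg(1) h] .
    have "h \<cdot> m = u \<cdot> (c \<cdot> m)"
      using Comp_assoc[OF m_Hom c_Hom u(1)] u by simp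
    also have "\<dots> = zero_arr C (Dom C m) Y"
      using is_kernelD(2)[OF c(2) c_Hom] Comp_zero_right[OF u(1)] Hom_objects[OF m_Hom] by simp
    finally have "h \<cdot> r = zero_arr C (Dom C r) Y"
      using Comp_assoc[OF v(1) m_Hom h(1)] v Comp_zero_left[OF v(1) Y] by simp
    then obtain u where "u \<in> Hom C (Cod C g) Y" "u \<cdot> g = h"
      by (rule is_cokernel_factor[OF r r_Hom h(1)])
    then show "\<exists>u\<in>Hom C D Y. u \<cdot> g = h"
      by (auto simp: D_def)
  qed
qed

text \<open>The epimorphism \<open>e\<close> is a cokernel of some \<open>r\<close>; precomposing \<open>r\<close> with an epimorphism from a
  projective does not change the arrows that kill it, so \<open>e\<close> is a cokernel of the composite as well.
  Together with an epimorphism from a projective onto \<open>A\<close> this gives a projective presentation of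
  \<open>A\<close>.\<close>

lemma epic_is_cokernel_from_projective:
  assumes "enough_projectives C" "epic C e" "e \<in> Hom C P A"
  obtains Q d where "projective C Q" "d \<in> Hom C Q P" "is_cokernel C d e"
proof -
  obtain r where r: "is_cokernel C r e"
    using epic_is_cokernel[OF assms(2)] by blast
  have r_Hom: "r \<in> Hom C (Dom C r) P" and er: "e \<cdot> r = zero_arr C (Dom C r) A"
    using is_cokernelD[OF r assms(3)] by auto
  obtain Q q where Q: "projective C Q" and q: "q \<in> Hom C Q (Dom C r)" "epic C q"
    using assms(1) Hom_objects[OF r_Hom] by (force simp: enough_projectives_def)
  have d: "r \<cdot> q \<in> Hom C Q P"
    using Comp_in_Hom[OF q(1) r_Hom] .
  have A: "A \<in> Obj C"
    using Hom_objects[OF assms(3)] by simp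
  have "is_cokernel C (r \<cdot> q) e"
  proof (rule is_cokernelI_epic[OF d assms(3,2)])
    show "e \<cdot> (r \<cdot> q) = zero_arr C Q A"
      using Comp_assoc[OF q(1) r_Hom assms(3)] er Comp_zero_left[OF q(1) A] by simp
    fix Y h assume h: "h \<in> Hom C P Y" "h \<cdot> (r \<cdot> q) = zero_arr C Q Y"
    have Y: "Y \<in> Obj C"
      using Hom_objects[OF h(1)] by simp
    have "(h \<cdot> r) \<cdot> q = zero_arr C (Dom C r) Y \<cdot> q"
      using h(2) Comp_assoc[OF q(1) r_Hom h(1)] Comp_zero_left[OF q(1) Y] by simp
    then have "h \<cdot> r = zero_arr C (Dom C r) Y"
      using epic_cancel[OF q(2,1) Comp_in_Hom[OF r_Hom h(1)]] zero_arr_in_Hom[OF _ Y]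
        Hom_objects[OF r_Hom] by simp
    then obtain u where "u \<in> Hom C (Cod C e) Y" "u \<cdot> e = h"
      by (rule is_cokernel_factor[OF r r_Hom h(1)])
    then show "\<exists>u\<in>Hom C A Y. u \<cdot> e = h"
      using assms(3) by (auto simp: Hom_def)
  qed
  with Q d show thesis
    by (rule that)
qed

end

section \<open>Extending transformations from the projectives\<close>

text \<open>The restricted functors agree with the original ones on the subcategory, so they can be
  eliminated from the description of the transformations between their restrictions.\<close>

lemma Nat_full_subcategory:
  fixes C :: "('o1, 'm1, 'x) category_scheme" and D :: "('o2, 'm2, 'y) category_scheme"
    and F G :: "('o1, 'm1, 'o2, 'm2) functor_data"
  shows "Nat (full_subcategory C S) D
      (restrict_functor F (full_subcategory C S)) (restrict_functor G (full_subcategory C S)) =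
    {\<sigma> \<in> (\<Pi>\<^sub>E P\<in>Obj C \<inter> S. Hom D (fobj F P) (fobj G P)).
      \<forall>P\<in>S. \<forall>Q\<in>S. \<forall>f\<in>Hom C P Q. \<sigma> Q \<cdot>\<^bsub>D\<^esub> farr F f = farr G f \<cdot>\<^bsub>D\<^esub> \<sigma> P}"
proof -
  let ?S = "full_subcategory C S"
  have Obj: "Obj ?S = Obj C \<inter> S"
    by (simp add: full_subcategory_def)
  have farr: "farr (restrict_functor H ?S) f = farr H f" if "f \<in> Hom C P Q" "P \<in> S" "Q \<in> S"
    for H :: "('o1, 'm1, 'o2, 'm2) functor_data" and f P Q
    using that by (simp add: restrict_functor_def full_subcategory_def Hom_def)
  have "(\<Pi>\<^sub>E P\<in>Obj ?S. Hom D (fobj (restrict_functor F ?S) P) (fobj (restrict_functor G ?S) P))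
      = (\<Pi>\<^sub>E P\<in>Obj C \<inter> S. Hom D (fobj F P) (fobj G P))"
    unfolding Obj by (rule PiE_cong) (simp add: restrict_functor_def Obj)
  moreover have "(\<forall>P Q. \<forall>f\<in>Hom ?S P Q. \<sigma> Q \<cdot>\<^bsub>D\<^esub> farr (restrict_functor F ?S) f
        = farr (restrict_functor G ?S) f \<cdot>\<^bsub>D\<^esub> \<sigma> P) \<longleftrightarrow>
      (\<forall>P\<in>S. \<forall>Q\<in>S. \<forall>f\<in>Hom C P Q. \<sigma> Q \<cdot>\<^bsub>D\<^esub> farr F f = farr G f \<cdot>\<^bsub>D\<^esub> \<sigma> P)" for \<sigma>
    by (intro iffI allI ballI; use farr in \<open>simp add: Hom_full_subcategory split: if_splits\<close>)
  ultimately show ?thesis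
    unfolding Nat_def by simp
qed

lemma projective_Obj: "projective C P \<Longrightarrow> P \<in> Obj C"
  by (simp add: projective_def)

lemma Obj_projectives: "Obj (projectives C) = {P. projective C P}"
  by (auto simp: projectives_def full_subcategory_def projective_def)

lemma Nat_projectives:
  "Nat (projectives C) D (restrict_functor F (projectives C)) (restrict_functor G (projectives C)) =
    {\<sigma> \<in> (\<Pi>\<^sub>E P\<in>{P. projective C P}. Hom D (fobj F P) (fobj G P)).
      \<forall>P Q. projective C P \<longrightarrow> projective C Q \<longrightarrow>
        (\<forall>f\<in>Hom C P Q. \<sigma> Q \<cdot>\<^bsub>D\<^esub> farr F f = farr G f \<cdot>\<^bsub>D\<^esub> \<sigma> P)}"
proof -
  have "Obj C \<inter> {P. projective C P} = {P. projective C P}"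
    by (auto simp: projective_def)
  then show ?thesis
    unfolding projectives_def Nat_full_subcategory by auto
qed

locale right_exact_functors =
  src: complex_linear_abelian_category C + tgt: complex_linear_abelian_category D
  for C :: "('o1, 'm1, 'x) lin_category_scheme" and D :: "('o2, 'm2, 'y) lin_category_scheme" +
  fixes F G :: "('o1, 'm1, 'o2, 'm2) functor_data"
  assumes enough: "enough_projectives C"
    and F_right_exact: "right_exact_functor C D F"
    and G_right_exact: "right_exact_functor C D G"
begin

sublocale F: category_functor C D F
  using F_right_exact by (simp add: right_exact_functor_def)

sublocale G: category_functor C D G
  using G_right_exact by (simp add: right_exact_functor_def)

lemma F_cokernel: "is_cokernel C f g \<Longrightarrow> is_cokernel D (farr F f) (farr F g)"
  using F_right_exact
  by (simp add: right_exact_functor_def src.right_exact_sequence_iff_is_cokernel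
    tgt.right_exact_sequence_iff_is_cokernel)

lemma G_cokernel: "is_cokernel C f g \<Longrightarrow> is_cokernel D (farr G f) (farr G g)"
  using G_right_exact
  by (simp add: right_exact_functor_def src.right_exact_sequence_iff_is_cokernel
    tgt.right_exact_sequence_iff_is_cokernel)

lemma ex_epic_from_projective:
  assumes "A \<in> Obj C"
  obtains P e where "projective C P" "e \<in> Hom C P A" "epic C e" "epic D (farr F e)"
proof -
  obtain P e where P: "projective C P" "e \<in> Hom C P A" "epic C e"
    using enough assms unfolding enough_projectives_def by blast
  moreover have "epic D (farr F e)"
    using src.epic_is_cokernel[OF P(3)] F_cokernel tgt.is_cokernel_epic by blast
  ultimately show thesis
    using that by blast
qed

text \<open>Arrows out of \<open>F A\<close> are separated by the arrows \<open>F f\<close> with \<open>f\<close> from a projective to \<open>A\<close>,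
  since among the latter there is an epimorphism, which \<open>F\<close> preserves. Uniqueness and
  naturality of extensions reduce to this.\<close>

lemma component_ext:
  assumes A: "A \<in> Obj C"
    and st: "s \<in> Hom D (fobj F A) Y" "t \<in> Hom D (fobj F A) Y"
    and eq: "\<And>P f. \<lbrakk>projective C P; f \<in> Hom C P A\<rbrakk> \<Longrightarrow> s \<cdot>\<^bsub>D\<^esub> farr F f = t \<cdot>\<^bsub>D\<^esub> farr F f"
  shows "s = t"
proof -
  obtain P e where P: "projective C P" "e \<in> Hom C P A" "epic D (farr F e)"
    using ex_epic_from_projective[OF A] by metis
  show ?thesis
    using tgt.epic_cancel[OF P(3) F.farr_in_Hom[OF P(2)] st eq[OF P(1,2)]] .
qed

abbreviation Nat_on_projectives :: "('o1 \<Rightarrow> 'm2) set"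
  where "Nat_on_projectives \<equiv>
    Nat (projectives C) D (restrict_functor F (projectives C)) (restrict_functor G (projectives C))"

lemma Nat_on_projectives_Hom:
  "\<lbrakk>\<sigma> \<in> Nat_on_projectives; projective C P\<rbrakk> \<Longrightarrow> \<sigma> P \<in> Hom D (fobj F P) (fobj G P)"
  unfolding Nat_projectives by auto

lemma Nat_on_projectives_naturality:
  "\<lbrakk>\<sigma> \<in> Nat_on_projectives; projective C P; projective C Q; f \<in> Hom C P Q\<rbrakk> \<Longrightarrow>
    \<sigma> Q \<cdot>\<^bsub>D\<^esub> farr F f = farr G f \<cdot>\<^bsub>D\<^esub> \<sigma> P"
  unfolding Nat_projectives by auto

text \<open>This is the part of naturality of an extension of \<open>\<sigma>\<close> that concerns its component at \<open>A\<close>.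
  Quantifying over all arrows from projectives, and not fixing a presentation of \<open>A\<close>, makes the
  component canonical.\<close>

definition extends_at :: "('o1 \<Rightarrow> 'm2) \<Rightarrow> 'o1 \<Rightarrow> 'm2 \<Rightarrow> bool"
  where "extends_at \<sigma> A t \<longleftrightarrow> t \<in> Hom D (fobj F A) (fobj G A) \<and>
    (\<forall>P f. projective C P \<longrightarrow> f \<in> Hom C P A \<longrightarrow> t \<cdot>\<^bsub>D\<^esub> farr F f = farr G f \<cdot>\<^bsub>D\<^esub> \<sigma> P)"

lemma ex_extends_at:
  assumes \<sigma>: "\<sigma> \<in> Nat_on_projectives" and A: "A \<in> Obj C"
  shows "\<exists>t. extends_at \<sigma> A t"
proof -
  note \<sigma>_Hom = Nat_on_projectives_Hom[OF \<sigma>] and \<sigma>_nat = Nat_on_projectives_naturality[OF \<sigma>]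
  obtain P e where P: "projective C P" and e: "e \<in> Hom C P A" "epic C e"
    using ex_epic_from_projective[OF A] .
  obtain Q d where Q: "projective C Q" and d: "d \<in> Hom C Q P" "is_cokernel C d e"
    using src.epic_is_cokernel_from_projective[OF enough e(2,1)] .
  note Fd = F.farr_in_Hom[OF d(1)] and Fe = F.farr_in_Hom[OF e(1)]
  note Gd = G.farr_in_Hom[OF d(1)] and Ge = G.farr_in_Hom[OF e(1)]
  let ?h = "farr G e \<cdot>\<^bsub>D\<^esub> \<sigma> P"
  have h: "?h \<in> Hom D (fobj F P) (fobj G A)"
    using tgt.Comp_in_Hom \<sigma>_Hom[OF P] Ge by blast
  have Ged: "farr G e \<cdot>\<^bsub>D\<^esub> farr G d = zero_arr D (fobj G Q) (fobj G A)"
    using tgt.is_cokernelD(2)[OF G_cokernel[OF d(2)] Ge] Gd by (simp add: Hom_def)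
  have "?h \<cdot>\<^bsub>D\<^esub> farr F d = farr G e \<cdot>\<^bsub>D\<^esub> (farr G d \<cdot>\<^bsub>D\<^esub> \<sigma> Q)"
    using tgt.Comp_assoc[OF Fd \<sigma>_Hom[OF P] Ge] \<sigma>_nat[OF Q P d(1)] by simp
  also have "\<dots> = zero_arr D (fobj F Q) (fobj G A)"
    using tgt.Comp_assoc[OF \<sigma>_Hom[OF Q] Gd Ge] Ged tgt.Comp_zero_left[OF \<sigma>_Hom[OF Q]]
      tgt.Hom_objects[OF Ge] by simp
  finally have "?h \<cdot>\<^bsub>D\<^esub> farr F d = zero_arr D (fobj F Q) (fobj G A)" .
  from tgt.is_cokernel_factor[OF F_cokernel[OF d(2)] Fd h this]
  obtain t where "t \<in> Hom D (Cod D (farr F e)) (fobj G A)" "t \<cdot>\<^bsub>D\<^esub> farr F e = ?h" .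
  then have t: "t \<in> Hom D (fobj F A) (fobj G A)" "t \<cdot>\<^bsub>D\<^esub> farr F e = ?h"
    using Fe by (simp_all add: Hom_def)
  \<comment> \<open>Every other arrow from a projective factors through the chosen epimorphism \<open>e\<close>.\<close>
  have "t \<cdot>\<^bsub>D\<^esub> farr F f = farr G f \<cdot>\<^bsub>D\<^esub> \<sigma> R"
    if R: "projective C R" and f: "f \<in> Hom C R A" for R f
  proof -
    obtain g where g: "g \<in> Hom C R P" "e \<cdot>\<^bsub>C\<^esub> g = f"
      using src.projective_lift[OF R e(2,1) f] .
    note Fg = F.farr_in_Hom[OF g(1)] and Gg = G.farr_in_Hom[OF g(1)]
    have "t \<cdot>\<^bsub>D\<^esub> farr F f = ?h \<cdot>\<^bsub>D\<^esub> farr F g"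
      using F.farr_Comp[OF g(1) e(1)] g(2) tgt.Comp_assoc[OF Fg Fe t(1)] t(2) by simp
    also have "\<dots> = farr G e \<cdot>\<^bsub>D\<^esub> (farr G g \<cdot>\<^bsub>D\<^esub> \<sigma> R)"
      using tgt.Comp_assoc[OF Fg \<sigma>_Hom[OF P] Ge] \<sigma>_nat[OF R P g(1)] by simp
    also have "\<dots> = farr G f \<cdot>\<^bsub>D\<^esub> \<sigma> R"
      using tgt.Comp_assoc[OF \<sigma>_Hom[OF R] Gg Ge] G.farr_Comp[OF g(1) e(1)] g(2) by simp
    finally show ?thesis .
  qed
  then show ?thesis
    using t(1) by (auto simp: extends_at_def)
qed

text \<open>Both sides are tested against the arrows from projectives to \<open>A\<close>. Composed with \<open>a\<close> these
  are arrows from projectives to \<open>B\<close>, with which \<open>t\<close> is compatible.\<close>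

lemma extends_at_natural:
  assumes \<sigma>: "\<sigma> \<in> Nat_on_projectives"
    and a: "a \<in> Hom C A B" and s: "extends_at \<sigma> A s" and t: "extends_at \<sigma> B t"
  shows "t \<cdot>\<^bsub>D\<^esub> farr F a = farr G a \<cdot>\<^bsub>D\<^esub> s"
proof -
  note Fa = F.farr_in_Hom[OF a] and Ga = G.farr_in_Hom[OF a]
  have s_Hom: "s \<in> Hom D (fobj F A) (fobj G A)" and t_Hom: "t \<in> Hom D (fobj F B) (fobj G B)"
    using s t by (auto simp: extends_at_def)
  have A: "A \<in> Obj C"
    using src.Hom_objects[OF a] by simp
  show ?thesis
  proof (rule component_ext[OF A tgt.Comp_in_Hom[OF Fa t_Hom] tgt.Comp_in_Hom[OF s_Hom Ga]])
    fix P f assume P: "projective C P" and f: "f \<in> Hom C P A"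
    note Ff = F.farr_in_Hom[OF f] and Gf = G.farr_in_Hom[OF f]
    have af: "a \<cdot>\<^bsub>C\<^esub> f \<in> Hom C P B"
      using src.Comp_in_Hom[OF f a] .
    \<comment> \<open>The extension property at \<open>B\<close> is used for \<open>a \<cdot> f\<close>, the one at \<open>A\<close> for \<open>f\<close>.
      The component of \<open>\<sigma>\<close> at \<open>P\<close> is the same in both.\<close>
    have \<sigma>P: "t \<cdot>\<^bsub>D\<^esub> farr F (a \<cdot>\<^bsub>C\<^esub> f) = farr G (a \<cdot>\<^bsub>C\<^esub> f) \<cdot>\<^bsub>D\<^esub> \<sigma> P"
      "s \<cdot>\<^bsub>D\<^esub> farr F f = farr G f \<cdot>\<^bsub>D\<^esub> \<sigma> P"
      using s t P f af by (auto simp: extends_at_def)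
    have "(t \<cdot>\<^bsub>D\<^esub> farr F a) \<cdot>\<^bsub>D\<^esub> farr F f = t \<cdot>\<^bsub>D\<^esub> farr F (a \<cdot>\<^bsub>C\<^esub> f)"
      using tgt.Comp_assoc[OF Ff Fa t_Hom] F.farr_Comp[OF f a] by simp
    also have "\<dots> = farr G a \<cdot>\<^bsub>D\<^esub> (farr G f \<cdot>\<^bsub>D\<^esub> \<sigma> P)"
      using \<sigma>P(1) tgt.Comp_assoc[OF Nat_on_projectives_Hom[OF \<sigma> P] Gf Ga] G.farr_Comp[OF f a]
      by simp
    also have "\<dots> = (farr G a \<cdot>\<^bsub>D\<^esub> s) \<cdot>\<^bsub>D\<^esub> farr F f"
      using \<sigma>P(2) tgt.Comp_assoc[OF Ff s_Hom Ga] by simp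
    finally show "(t \<cdot>\<^bsub>D\<^esub> farr F a) \<cdot>\<^bsub>D\<^esub> farr F f = (farr G a \<cdot>\<^bsub>D\<^esub> s) \<cdot>\<^bsub>D\<^esub> farr F f" .
  qed
qed

lemma extends_at_projective:
  assumes \<sigma>: "\<sigma> \<in> Nat_on_projectives" and P: "projective C P" and t: "extends_at \<sigma> P t"
  shows "t = \<sigma> P"
proof -
  \<comment> \<open>At a projective object the identity is one of the arrows from projectives.\<close>
  have i: "Idt C P \<in> Hom C P P"
    using src.Idt_in_Hom projective_Obj[OF P] .
  then have "t \<cdot>\<^bsub>D\<^esub> farr F (Idt C P) = farr G (Idt C P) \<cdot>\<^bsub>D\<^esub> \<sigma> P" and "t \<in> Hom D (fobj F P) (fobj G P)"
    using t P by (auto simp: extends_at_def)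
  then show ?thesis
    using F.farr_Idt G.farr_Idt projective_Obj[OF P] tgt.Comp_Idt_right tgt.Comp_Idt_left
      Nat_on_projectives_Hom[OF \<sigma> P] by metis
qed

lemma Nat_in_Hom: "\<lbrakk>\<tau> \<in> Nat C D F G; A \<in> Obj C\<rbrakk> \<Longrightarrow> \<tau> A \<in> Hom D (fobj F A) (fobj G A)"
  by (auto simp: Nat_def)

lemma Nat_naturality:
  "\<lbrakk>\<tau> \<in> Nat C D F G; f \<in> Hom C A B\<rbrakk> \<Longrightarrow> \<tau> B \<cdot>\<^bsub>D\<^esub> farr F f = farr G f \<cdot>\<^bsub>D\<^esub> \<tau> A"
  by (auto simp: Nat_def)

lemma restrict_nat_projective: "projective C P \<Longrightarrow> restrict_nat (projectives C) \<tau> P = \<tau> P"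
  by (simp add: restrict_nat_def Obj_projectives)

lemma restrict_nat_in_Nat_on_projectives:
  assumes "\<tau> \<in> Nat C D F G"
  shows "restrict_nat (projectives C) \<tau> \<in> Nat_on_projectives"
  unfolding Nat_projectives
  using assms Nat_in_Hom Nat_naturality projective_Obj[of C]
  by (auto simp: restrict_nat_def Obj_projectives)

lemma inj_on_restrict_nat: "inj_on (restrict_nat (projectives C)) (Nat C D F G)"
proof (rule inj_onI)
  fix \<tau> \<tau>'
  assume \<tau>: "\<tau> \<in> Nat C D F G" and \<tau>': "\<tau>' \<in> Nat C D F G"
    and eq: "restrict_nat (projectives C) \<tau> = restrict_nat (projectives C) \<tau>'"
  have "\<tau> A = \<tau>' A" if A: "A \<in> Obj C" for A
  proof (rule component_ext[OF A Nat_in_Hom[OF \<tau> A] Nat_in_Hom[OF \<tau>' A]])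
    fix P f assume P: "projective C P" and f: "f \<in> Hom C P A"
    have "\<tau> P = \<tau>' P"
      using eq restrict_nat_projective[OF P] by metis
    then show "\<tau> A \<cdot>\<^bsub>D\<^esub> farr F f = \<tau>' A \<cdot>\<^bsub>D\<^esub> farr F f"
      using Nat_naturality[OF \<tau> f] Nat_naturality[OF \<tau>' f] by simp
  qed
  moreover have "\<tau> \<in> extensional (Obj C)" "\<tau>' \<in> extensional (Obj C)"
    using \<tau> \<tau>' by (auto simp: Nat_def PiE_def)
  ultimately show "\<tau> = \<tau>'"
    by (intro extensionalityI[of \<tau> "Obj C" \<tau>'])
qed

lemma ex_extension:
  assumes \<sigma>: "\<sigma> \<in> Nat_on_projectives"
  obtains \<tau> where "\<tau> \<in> Nat C D F G" "restrict_nat (projectives C) \<tau> = \<sigma>"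
proof -
  define \<tau> where "\<tau> = restrict (\<lambda>A. SOME t. extends_at \<sigma> A t) (Obj C)"
  have ext: "extends_at \<sigma> A (\<tau> A)" if "A \<in> Obj C" for A
    using someI_ex[OF ex_extends_at[OF \<sigma> that]] that by (simp add: \<tau>_def)
  have "\<tau> \<in> (\<Pi>\<^sub>E A\<in>Obj C. Hom D (fobj F A) (fobj G A))"
    using ext by (auto simp: extends_at_def \<tau>_def)
  moreover have "\<tau> B \<cdot>\<^bsub>D\<^esub> farr F f = farr G f \<cdot>\<^bsub>D\<^esub> \<tau> A" if "f \<in> Hom C A B" for A B f
    using extends_at_natural[OF \<sigma> that] ext src.Hom_objects[OF that] by blast
  ultimately have \<tau>: "\<tau> \<in> Nat C D F G"
    by (simp add: Nat_def)
  have "restrict_nat (projectives C) \<tau> = \<sigma>"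
  proof (rule extensionalityI)
    show "restrict_nat (projectives C) \<tau> \<in> extensional {P. projective C P}"
      by (simp add: restrict_nat_def Obj_projectives)
    show "\<sigma> \<in> extensional {P. projective C P}"
      using \<sigma> unfolding Nat_projectives by (auto simp: PiE_def)
    fix P assume "P \<in> {P. projective C P}"
    then have P: "projective C P"
      by simp
    show "restrict_nat (projectives C) \<tau> P = \<sigma> P"
      using extends_at_projective[OF \<sigma> P ext[OF projective_Obj[OF P]]]
      by (simp add: restrict_nat_projective[OF P])
  qed
  with \<tau> show thesis
    by (rule that)
qed

theorem bij_betw_restrict_nat:
  "bij_betw (restrict_nat (projectives C)) (Nat C D F G) Nat_on_projectives"
proof (rule bij_betw_imageI[OF inj_on_restrict_nat], intro subset_antisym subsetI)
  fix \<sigma> assume "\<sigma> \<in> Nat_on_projectives"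
  then obtain \<tau> where "\<tau> \<in> Nat C D F G" "restrict_nat (projectives C) \<tau> = \<sigma>"
    by (rule ex_extension)
  then show "\<sigma> \<in> restrict_nat (projectives C) ` Nat C D F G"
    by blast
qed (use restrict_nat_in_Nat_on_projectives in auto)

end

section \<open>Extending natural isomorphisms\<close>

context right_exact_functors
begin

lemma right_exact_functors_swap: "right_exact_functors C D G F"
  using enough F_right_exact G_right_exact by unfold_locales

text \<open>The composite \<open>\<rho>\<^sub>A \<cdot> \<tau>\<^sub>A\<close> is compared with the identity on arrows \<open>F f\<close> with \<open>f\<close> from a
  projective. The lemma is applied in both orders to obtain a two-sided inverse.\<close>

lemma retraction_if_retraction_on_projectives:
  assumes \<tau>: "\<tau> \<in> Nat C D F G" and \<rho>: "\<rho> \<in> Nat C D G F" and A: "A \<in> Obj C"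
    and inv: "\<And>P. projective C P \<Longrightarrow> \<rho> P \<cdot>\<^bsub>D\<^esub> \<tau> P = Idt D (fobj F P)"
  shows "\<rho> A \<cdot>\<^bsub>D\<^esub> \<tau> A = Idt D (fobj F A)"
proof -
  interpret GF: right_exact_functors C D G F
    by (rule right_exact_functors_swap)
  note \<tau>A = Nat_in_Hom[OF \<tau> A] and \<rho>A = GF.Nat_in_Hom[OF \<rho> A]
  show ?thesis
  proof (rule component_ext[OF A tgt.Comp_in_Hom[OF \<tau>A \<rho>A] tgt.Idt_in_Hom[OF F.fobj_in_Obj[OF A]]])
    fix P f assume P: "projective C P" and f: "f \<in> Hom C P A"
    note Ff = F.farr_in_Hom[OF f] and Gf = G.farr_in_Hom[OF f]
    note \<tau>P = Nat_in_Hom[OF \<tau> projective_Obj[OF P]]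
      and \<rho>P = GF.Nat_in_Hom[OF \<rho> projective_Obj[OF P]]
    have "(\<rho> A \<cdot>\<^bsub>D\<^esub> \<tau> A) \<cdot>\<^bsub>D\<^esub> farr F f = \<rho> A \<cdot>\<^bsub>D\<^esub> (farr G f \<cdot>\<^bsub>D\<^esub> \<tau> P)"
      using tgt.Comp_assoc[OF Ff \<tau>A \<rho>A] Nat_naturality[OF \<tau> f] by simp
    also have "\<dots> = farr F f \<cdot>\<^bsub>D\<^esub> (\<rho> P \<cdot>\<^bsub>D\<^esub> \<tau> P)"
      using tgt.Comp_assoc[OF \<tau>P Gf \<rho>A] tgt.Comp_assoc[OF \<tau>P \<rho>P Ff] GF.Nat_naturality[OF \<rho> f]
      by simp
    also have "\<dots> = Idt D (fobj F A) \<cdot>\<^bsub>D\<^esub> farr F f"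
      using inv[OF P] tgt.Comp_Idt_right[OF Ff] tgt.Comp_Idt_left[OF Ff] by simp
    finally show "(\<rho> A \<cdot>\<^bsub>D\<^esub> \<tau> A) \<cdot>\<^bsub>D\<^esub> farr F f = Idt D (fobj F A) \<cdot>\<^bsub>D\<^esub> farr F f" .
  qed
qed

text \<open>The chosen inverses are natural: insert \<open>\<sigma>\<^sub>P \<cdot> \<rho>\<^sub>P\<close> to the right of \<open>G f\<close>, move \<open>\<sigma>\<close> past
  \<open>G f\<close>, and cancel \<open>\<rho>\<^sub>Q \<cdot> \<sigma>\<^sub>Q\<close>.\<close>

lemma ex_inverse_on_projectives:
  assumes \<sigma>: "\<sigma> \<in> Nat_on_projectives" and iso: "\<And>P. projective C P \<Longrightarrow> iso_arrow D (\<sigma> P)"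
  obtains \<rho> where "\<rho> \<in> right_exact_functors.Nat_on_projectives C D G F"
    "\<And>P. projective C P \<Longrightarrow> \<rho> P \<cdot>\<^bsub>D\<^esub> \<sigma> P = Idt D (fobj F P)"
    "\<And>P. projective C P \<Longrightarrow> \<sigma> P \<cdot>\<^bsub>D\<^esub> \<rho> P = Idt D (fobj G P)"
proof -
  let ?inverse = "\<lambda>P r. r \<in> Hom D (fobj G P) (fobj F P) \<and>
    r \<cdot>\<^bsub>D\<^esub> \<sigma> P = Idt D (fobj F P) \<and> \<sigma> P \<cdot>\<^bsub>D\<^esub> r = Idt D (fobj G P)"
  define \<rho> where "\<rho> = restrict (\<lambda>P. SOME r. ?inverse P r) {P. projective C P}"
  note \<sigma>_Hom = Nat_on_projectives_Hom[OF \<sigma>] and \<sigma>_nat = Nat_on_projectives_naturality[OF \<sigma>]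
  have "\<exists>r. ?inverse P r" if "projective C P" for P
    using iso[OF that] \<sigma>_Hom[OF that] by (auto simp: iso_arrow_def Hom_def)
  then have \<rho>: "?inverse P (\<rho> P)" if "projective C P" for P
    using someI_ex[of "?inverse P"] that by (simp add: \<rho>_def)
  have "\<rho> Q \<cdot>\<^bsub>D\<^esub> farr G f = farr F f \<cdot>\<^bsub>D\<^esub> \<rho> P"
    if P: "projective C P" and Q: "projective C Q" and f: "f \<in> Hom C P Q" for P Q f
  proof -
    note Ff = F.farr_in_Hom[OF f] and Gf = G.farr_in_Hom[OF f]
    have \<rho>P: "\<rho> P \<in> Hom D (fobj G P) (fobj F P)" and \<rho>Q: "\<rho> Q \<in> Hom D (fobj G Q) (fobj F Q)"
      using \<rho> P Q by auto
    have "\<rho> Q \<cdot>\<^bsub>D\<^esub> farr G f = \<rho> Q \<cdot>\<^bsub>D\<^esub> (farr G f \<cdot>\<^bsub>D\<^esub> (\<sigma> P \<cdot>\<^bsub>D\<^esub> \<rho> P))"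
      using \<rho>[OF P] tgt.Comp_Idt_right[OF Gf] by simp
    also have "\<dots> = \<rho> Q \<cdot>\<^bsub>D\<^esub> ((\<sigma> Q \<cdot>\<^bsub>D\<^esub> farr F f) \<cdot>\<^bsub>D\<^esub> \<rho> P)"
      using \<sigma>_nat[OF P Q f] tgt.Comp_assoc[OF \<rho>P \<sigma>_Hom[OF P] Gf] by simp
    also have "\<dots> = (\<rho> Q \<cdot>\<^bsub>D\<^esub> \<sigma> Q) \<cdot>\<^bsub>D\<^esub> (farr F f \<cdot>\<^bsub>D\<^esub> \<rho> P)"
      using tgt.Comp_assoc[OF \<rho>P Ff \<sigma>_Hom[OF Q]]
        tgt.Comp_assoc[OF tgt.Comp_in_Hom[OF \<rho>P Ff] \<sigma>_Hom[OF Q] \<rho>Q] by simp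
    also have "\<dots> = farr F f \<cdot>\<^bsub>D\<^esub> \<rho> P"
      using \<rho>[OF Q] tgt.Comp_Idt_left[OF tgt.Comp_in_Hom[OF \<rho>P Ff]] by simp
    finally show ?thesis .
  qed
  then have "\<rho> \<in> right_exact_functors.Nat_on_projectives C D G F"
    unfolding Nat_projectives using \<rho> by (auto simp: \<rho>_def)
  then show thesis
    using \<rho> by (intro that) auto
qed

lemma NatIso_if_iso_on_projectives:
  assumes \<tau>: "\<tau> \<in> Nat C D F G" and iso: "\<And>P. projective C P \<Longrightarrow> iso_arrow D (\<tau> P)"
  shows "\<tau> \<in> NatIso C D F G"
proof -
  interpret GF: right_exact_functors C D G F
    by (rule right_exact_functors_swap)
  have "\<And>P. projective C P \<Longrightarrow> iso_arrow D (restrict_nat (projectives C) \<tau> P)"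
    using iso by (simp add: restrict_nat_projective)
  then obtain \<rho>' where \<rho>': "\<rho>' \<in> GF.Nat_on_projectives"
    "\<And>P. projective C P \<Longrightarrow> \<rho>' P \<cdot>\<^bsub>D\<^esub> restrict_nat (projectives C) \<tau> P = Idt D (fobj F P)"
    "\<And>P. projective C P \<Longrightarrow> restrict_nat (projectives C) \<tau> P \<cdot>\<^bsub>D\<^esub> \<rho>' P = Idt D (fobj G P)"
    using ex_inverse_on_projectives[OF restrict_nat_in_Nat_on_projectives[OF \<tau>]] by blast
  obtain \<rho> where \<rho>: "\<rho> \<in> Nat C D G F" "restrict_nat (projectives C) \<rho> = \<rho>'"
    using GF.ex_extension[OF \<rho>'(1)] .
  have inv: "\<rho> P \<cdot>\<^bsub>D\<^esub> \<tau> P = Idt D (fobj F P)" "\<tau> P \<cdot>\<^bsub>D\<^esub> \<rho> P = Idt D (fobj G P)"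
    if "projective C P" for P
    using \<rho>'(2,3)[OF that] restrict_nat_projective[OF that] \<rho>(2) by metis+
  have "iso_arrow D (\<tau> A)" if A: "A \<in> Obj C" for A
    using retraction_if_retraction_on_projectives[OF \<tau> \<rho>(1) A inv(1)]
      GF.retraction_if_retraction_on_projectives[OF \<rho>(1) \<tau> A inv(2)]
      Nat_in_Hom[OF \<tau> A] GF.Nat_in_Hom[OF \<rho>(1) A]
    by (auto simp: iso_arrow_def Hom_def)
  with \<tau> show ?thesis
    by (simp add: NatIso_def)
qed

theorem ex1_NatIso_extension:
  assumes "\<sigma> \<in> NatIso (projectives C) D
    (restrict_functor F (projectives C)) (restrict_functor G (projectives C))"
  shows "\<exists>!\<tau>. \<tau> \<in> NatIso C D F G \<and> restrict_nat (projectives C) \<tau> = \<sigma>"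
proof -
  have \<sigma>: "\<sigma> \<in> Nat_on_projectives" "\<And>P. projective C P \<Longrightarrow> iso_arrow D (\<sigma> P)"
    using assms by (auto simp: NatIso_def Obj_projectives)
  obtain \<tau> where \<tau>: "\<tau> \<in> Nat C D F G" "restrict_nat (projectives C) \<tau> = \<sigma>"
    using ex_extension[OF \<sigma>(1)] .
  have "\<tau> \<in> NatIso C D F G"
    using NatIso_if_iso_on_projectives[OF \<tau>(1)] \<sigma>(2) \<tau>(2) restrict_nat_projective by metis
  moreover have "\<tau>' = \<tau>" if "\<tau>' \<in> NatIso C D F G" "restrict_nat (projectives C) \<tau>' = \<sigma>" for \<tau>'
    using that \<tau> inj_onD[OF inj_on_restrict_nat] by (auto simp: NatIso_def)
  ultimately show ?thesis
    using \<tau>(2) by blast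
qed

end

theorem proposition6p9:
  fixes \<A> :: "('o1, 'm1) lin_category"
    and \<B> :: "('o2, 'm2) lin_category"
    and G1 G2 :: "('o1, 'm1, 'o2, 'm2) functor_data"
  assumes "complex_linear_abelian_category \<A>"
    and "enough_projectives \<A>"
    and "complex_linear_abelian_category \<B>"
    and "additive_functor \<A> \<B> G1" and "complex_linear_functor \<A> \<B> G1"
    and "right_exact_functor \<A> \<B> G1"
    and "additive_functor \<A> \<B> G2" and "complex_linear_functor \<A> \<B> G2"
    and "right_exact_functor \<A> \<B> G2"
  shows "bij_betw (restrict_nat (projectives \<A>)) (Nat \<A> \<B> G1 G2)
           (Nat (projectives \<A>) \<B> (restrict_functor G1 (projectives \<A>))
              (restrict_functor G2 (projectives \<A>)))
    \<and> (\<forall>\<sigma>\<in>NatIso (projectives \<A>) \<B> (restrict_functor G1 (projectives \<A>))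
              (restrict_functor G2 (projectives \<A>)).
         \<exists>!\<tau>. \<tau> \<in> NatIso \<A> \<B> G1 G2 \<and> restrict_nat (projectives \<A>) \<tau> = \<sigma>)"
proof -
  interpret right_exact_functors \<A> \<B> G1 G2
    using assms by (intro right_exact_functors.intro right_exact_functors_axioms.intro)
  show ?thesis
    using bij_betw_restrict_nat ex1_NatIso_extension by blast
qed

end
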